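(* Let $\mathcal{A} = \{X_1, \dots, X_n\}$ be a set of real-valued random variables on a common probability space with $a_i \leq X_i \leq b_i$ for some $a_i, b_i \in \mathbb{R}$, $i=1,\dots,n$, and let $r(\mathcal{A}) = \max_{1\leq i\leq n}|b_i-a_i|$. Then, for any threshold $\gamma > 0$, any $t > 0$ and any $0<\lambda < t$, $$\mathbb{P}\Big[\frac{1}{n}\sum_{i=1}^n X_i - \frac{1}{n} \sum_{i=1}^n\mathbb{E}[X_i] > t \Big] \leq \exp\Big(-\frac{2n^2(t-\lambda)^2}{\chi_\gamma(\mathcal{A}) \sum_{i=1}^n(b_i-a_i)^2}\Big) + 18\,n\,\gamma\,\sqrt{\frac{r(\mathcal{A})}{\lambda}}.$$
   Context: For two sub-$\sigma$-algebras $\mathcal{B},\mathcal{C}$ of a probability space $(\Omega,\mathcal{F},\mathbb{P})$, $\alpha(\mathcal{B}|\mathcal{C}) = \sup_{B\in\mathcal{B}, C\in\mathcal{C}} |\mathbb{P}[B\cap C] - \mathbb{P}[B]\mathbb{P}[C]|$. For random variables (or families of random variables) $X,Y$, $\alpha(X|Y) = \alpha(\sigma(X)|\sigma(Y))$, where $\sigma(\cdot)$ is the generated $\sigma$-algebra. The $\alpha$-separation coefficient of a set of random variables $\{Z_1,\dots,Z_k\}$ is $$\vec{\alpha}(\{Z_1,\dots,Z_k\}) = \min_{\pi\in\Pi_k} \frac{1}{k}\sum_{i=1}^{k-1}\alpha\big(Z_{\pi(i)} \,\big|\, \{Z_{\pi(i+1)},\dots,Z_{\pi(k)}\}\big),$$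 with $\Pi_k$ the set of all permutations of $1,\dots,k$. For a set of random variables $\mathcal{A}=\{X_1,\dots,X_n\}$ and an index set $\mathcal{I}\subseteq[n]=\{1,\dots,n\}$, write $\vec{\alpha}(\mathcal{I})$ for the $\alpha$-separation coefficient of $\{X_i : i\in\mathcal{I}\}$. Given $\gamma\ge 0$, $\mathcal{I}\subseteq[n]$ is called $\gamma$-independent if $\vec{\alpha}(\mathcal{I})\leq\gamma$. A family $\{\mathcal{I}_j\}$ of subsets of $[n]$ is a cover of $\mathcal{A}$ if $\bigcup_j\mathcal{I}_j=[n]$; a cover is soft (for the threshold $\gamma$) if each $\mathcal{I}_j$ is $\gamma$-independent. $\chi_\gamma(\mathcal{A})$ is the size (number of sets) of the smallest soft cover of $\mathcal{A}$ for the given $\gamma$. *)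

theory Defs
  imports "HOL-Probability.Probability"
begin

definition alpha_mixing :: "'a measure \<Rightarrow> 'a set set \<Rightarrow> 'a set set \<Rightarrow> real" where
  "alpha_mixing M \<B> \<C> =
     (SUP (B, C) \<in> \<B> \<times> \<C>. \<bar>measure M (B \<inter> C) - measure M B * measure M C\<bar>)"

definition generated_events :: "'a measure \<Rightarrow> ('i \<Rightarrow> 'a \<Rightarrow> real) \<Rightarrow> 'i set \<Rightarrow> 'a set set" where
  "generated_events M X J =
     sigma_sets (space M) {X j -` A \<inter> space M | j A. j \<in> J \<and> A \<in> sets borel}"

text \<open>
  With \<open>I\<close> enumerated as $i_1, \dots, i_k$ and $Z_l = X_{i_l}$, the orderings
  $Z_{\pi(1)}, \dots, Z_{\pi(k)}$ for permutations $\pi$ of $\{1,\dots,k\}$ are exactly those given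
  by the bijections from $\{1,\dots,k\}$ onto \<open>I\<close>. Using extensional functions makes their set
  finite, so that \<open>Min\<close> applies. The variables are indexed: two indices carrying the same function
  are counted separately. For empty \<open>I\<close> the value is 0, since \<open>1 / 0 = 0\<close> and the sum is empty.
\<close>

definition alpha_separation :: "'a measure \<Rightarrow> ('i \<Rightarrow> 'a \<Rightarrow> real) \<Rightarrow> 'i set \<Rightarrow> real" where
  "alpha_separation M X I =
     (let k = card I in
      Min ((\<lambda>\<pi>. 1 / real k *
                 (\<Sum>i = 1..<k. alpha_mixing M (generated_events M X {\<pi> i})
                                           (generated_events M X (\<pi> ` {i+1..k}))))
           ` {\<pi> \<in> {1..k} \<rightarrow>\<^sub>E I. bij_betw \<pi> {1..k} I}))"

definition gamma_independent :: "'a measure \<Rightarrow> ('i \<Rightarrow> 'a \<Rightarrow> real) \<Rightarrow> real \<Rightarrow> 'i set \<Rightarrow> bool" where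
  "gamma_independent M X \<gamma> I \<longleftrightarrow> alpha_separation M X I \<le> \<gamma>"

definition soft_cover ::
    "'a measure \<Rightarrow> (nat \<Rightarrow> 'a \<Rightarrow> real) \<Rightarrow> nat \<Rightarrow> real \<Rightarrow> nat set set \<Rightarrow> bool" where
  "soft_cover M X n \<gamma> \<J> \<longleftrightarrow>
     \<J> \<subseteq> Pow {1..n} \<and> \<Union>\<J> = {1..n} \<and> (\<forall>I\<in>\<J>. gamma_independent M X \<gamma> I)"

text \<open>
  For $\gamma \ge 0$ a soft cover always exists (the singletons form one), so \<open>LEAST\<close> is attained.
\<close>

definition soft_chromatic :: "'a measure \<Rightarrow> (nat \<Rightarrow> 'a \<Rightarrow> real) \<Rightarrow> nat \<Rightarrow> real \<Rightarrow> nat" where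
  "soft_chromatic M X n \<gamma> = (LEAST m. \<exists>\<J>. soft_cover M X n \<gamma> \<J> \<and> card \<J> = m)"

end

theory Submission
  imports Defs
begin

text \<open>
  Write $c_i = b_i - a_i$, $s = n t$, $l = n \lambda$, and let $S = \sum_i (X_i - E X_i)$.
  The proof replaces the indicator of $\{S > s\}$ by a hinge $L (S - \theta)_+$ with
  $\theta = s - 1/L$. A hinge has two virtues that an exponential does not combine: it is
  Lipschitz, so that weak dependence costs little, and it is subadditive, so that the sets of a
  cover can be treated separately although nothing is known about their joint behaviour.

  For one variable $X \in [a,b]$ and a remainder $Y$, the layer-cake formula writes
  $(X + Y - \theta)_+$ as $(a + Y - \theta)_+$ plus the integral over $u \in [a,b]$ of the
  indicator of $\{X > u\} \cap \{Y > \theta - u\}$. Making $X$ independent of $Y$ thus changes the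
  expectation by at most $(b - a)\alpha$ (\<open>hinge_decouple\<close>). Peeling off the variables along an
  ordering, bounding $y_+ \le e^{hy}/(eh)$ at the end and using Hoeffding's lemma on the way gives
  $E (\sum Y_i - \theta)_+ \le e^{-h\theta + h^2 \sum c_i^2/8}/(eh) + \sum c_i \alpha_i$
  (\<open>hinge_sum_le\<close>). No coupling of random variables is constructed.

  Given a soft cover, assign each index to one cover set containing it, let $v_J$ be the sum of
  the $c_i^2$ assigned to $J$, and put $W = \sum_J \sqrt{v_J}$. The variables of $J$ not assigned to
  it are replaced by 0, which does not destroy the ordering of $J$ that witnesses its
  $\gamma$-independence; so the mixing error of $J$ is at most
  $\sqrt{v_J}\, |J| \gamma \le \sqrt{v_J}\, n \gamma$ (\<open>gamma_independent_hinge_le\<close>). Splitting the hinge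
  with weights $\sqrt{v_J}/W$ yields, for all $L, h > 0$ (\<open>soft_cover_tail\<close>),
  $$P[S > s] \le \frac{L}{eh}\, e^{-h(s - 1/L) + h^2 W^2/8} + L W n \gamma ,$$
  where $W^2 \le |\mathcal{J}| \sum_i c_i^2$ by Cauchy--Schwarz. The error is proportional to $W$ and
  not to the total size of the overlapping cover sets; this is what keeps the number of sets out of
  the second term of the final bound.

  It remains to choose $L$ and $h$ (\<open>tail_bound_optimize\<close>). Hoeffding's choice $L = h = 4s/W^2$ is
  good when $s l \le W^2$, and $L = 2/l$ is good otherwise; either way the error is at most
  $4 n \gamma \sqrt{s/l} = 4 n \gamma \sqrt{t/\lambda}$. Finally $t \le r(\mathcal{A})$ unless the
  event is null, and $4 \le 18$.
\<close>

section \<open>Hinge moments of weakly dependent sums\<close>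

lemma hinge_layer_cake:
  fixes x y a b \<theta> :: real
  assumes "a \<le> x" "x \<le> b"
  shows "ennreal (x + y - \<theta>) = ennreal (a + y - \<theta>) +
    (\<integral>\<^sup>+u. indicator {a<..<b} u * (indicator {u<..} x * indicator {\<theta> - u<..} y) \<partial>lborel)"
proof -
  have "(\<integral>\<^sup>+u. indicator {a<..<b} u * (indicator {u<..} x * indicator {\<theta> - u<..} y) \<partial>lborel)
      = (\<integral>\<^sup>+u. indicator {max a (\<theta> - y)<..<x} u \<partial>lborel)"
    using assms by (intro nn_integral_cong) (auto simp: indicator_def)
  also have "\<dots> = ennreal (x - max a (\<theta> - y))"
    by (cases "max a (\<theta> - y) \<le> x") (auto simp: ennreal_neg)
  finally have integral: "(\<integral>\<^sup>+u. indicator {a<..<b} u * (indicator {u<..} x * indicator {\<theta> - u<..} y) \<partial>lborel)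
      = ennreal (x - max a (\<theta> - y))" .
  show ?thesis
  proof (cases "\<theta> - y \<le> a")
    case True
    have "ennreal (x + y - \<theta>) = ennreal ((a + y - \<theta>) + (x - a))"
      by (rule arg_cong[where f = ennreal]) simp
    also have "\<dots> = ennreal (a + y - \<theta>) + ennreal (x - a)"
      using True assms by (intro ennreal_plus) auto
    finally show ?thesis
      using True by (simp add: integral max_absorb1)
  next
    case False
    then have "ennreal (a + y - \<theta>) = 0"
      by (intro ennreal_neg) auto
    moreover have "x - max a (\<theta> - y) = x + y - \<theta>"
      using False by simp
    ultimately show ?thesis
      by (simp only: integral add_0)
  qed
qed

text \<open>
  By the layer-cake formula both sides are integrals over $u \in [a,b]$, the left one of the joint
  probabilities of $\{X > u\}$ and $\{Y > \theta - u\}$ and the right one of their products, so the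
  mixing error $\alpha$ is paid once per unit of length of $[a,b]$. Expectations are nonnegative
  integrals of \<open>ennreal\<close>, which sends negative numbers to 0 and thus is the hinge itself.
\<close>

lemma (in prob_space) hinge_decouple:
  fixes X Y :: "'a \<Rightarrow> real"
  assumes [measurable]: "X \<in> borel_measurable M" "Y \<in> borel_measurable M"
    and bounds: "AE \<omega> in M. a \<le> X \<omega> \<and> X \<omega> \<le> b"
    and "\<alpha> \<ge> 0"
    and dep: "\<And>u v. prob {\<omega> \<in> space M. u < X \<omega> \<and> v < Y \<omega>}
                \<le> prob {\<omega> \<in> space M. u < X \<omega>} * prob {\<omega> \<in> space M. v < Y \<omega>} + \<alpha>"
  shows "(\<integral>\<^sup>+\<omega>. ennreal (X \<omega> + Y \<omega> - \<theta>) \<partial>M)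
       \<le> (\<integral>\<^sup>+\<omega>. (\<integral>\<^sup>+\<omega>'. ennreal (X \<omega> + Y \<omega>' - \<theta>) \<partial>M) \<partial>M) + ennreal ((b - a) * \<alpha>)"
proof -
  interpret L: pair_sigma_finite M lborel ..
  define A where "A = (\<integral>\<^sup>+\<omega>. ennreal (a + Y \<omega> - \<theta>) \<partial>M)"
  have "a \<le> b"
  proof -
    have "AE \<omega> in M. a \<le> b" using bounds by eventually_elim auto
    then show ?thesis by simp
  qed
  have joint: "(\<integral>\<^sup>+\<omega>. indicator {u<..} (X \<omega>) * indicator {\<theta> - u<..} (Y \<omega>) \<partial>M)
      = ennreal (prob {\<omega> \<in> space M. u < X \<omega> \<and> \<theta> - u < Y \<omega>})" for u
  proof -
    have "(\<integral>\<^sup>+\<omega>. indicator {u<..} (X \<omega>) * indicator {\<theta> - u<..} (Y \<omega>) \<partial>M)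
        = (\<integral>\<^sup>+\<omega>. indicator {\<omega> \<in> space M. u < X \<omega> \<and> \<theta> - u < Y \<omega>} \<omega> \<partial>M)"
      by (intro nn_integral_cong) (auto simp: indicator_def)
    then show ?thesis by (simp add: emeasure_eq_measure)
  qed
  have marg: "(\<integral>\<^sup>+\<omega>. indicator {u<..} (Z \<omega>) \<partial>M) = ennreal (prob {\<omega> \<in> space M. u < Z \<omega>})"
    if [measurable]: "Z \<in> borel_measurable M" for u and Z :: "'a \<Rightarrow> real"
  proof -
    have "(\<integral>\<^sup>+\<omega>. indicator {u<..} (Z \<omega>) \<partial>M) = (\<integral>\<^sup>+\<omega>. indicator {\<omega> \<in> space M. u < Z \<omega>} \<omega> \<partial>M)"
      by (intro nn_integral_cong) (auto simp: indicator_def)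
    then show ?thesis by (simp add: emeasure_eq_measure)
  qed
  define J where "J = (\<integral>\<^sup>+u. indicator {a<..<b} u *
        ennreal (prob {\<omega> \<in> space M. u < X \<omega> \<and> \<theta> - u < Y \<omega>}) \<partial>lborel)"
  define P where "P = (\<integral>\<^sup>+u. indicator {a<..<b} u *
        ennreal (prob {\<omega> \<in> space M. u < X \<omega>} * prob {\<omega> \<in> space M. \<theta> - u < Y \<omega>}) \<partial>lborel)"
  have fubini_joint: "(\<integral>\<^sup>+\<omega>. (\<integral>\<^sup>+u. indicator {a<..<b} u *
           (indicator {u<..} (X \<omega>) * indicator {\<theta> - u<..} (Y \<omega>)) \<partial>lborel) \<partial>M) = J"
  proof -
    have "(\<integral>\<^sup>+\<omega>. (\<integral>\<^sup>+u. indicator {a<..<b} u *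
             (indicator {u<..} (X \<omega>) * indicator {\<theta> - u<..} (Y \<omega>)) \<partial>lborel) \<partial>M)
       = (\<integral>\<^sup>+u. (\<integral>\<^sup>+\<omega>. indicator {a<..<b} u *
             (indicator {u<..} (X \<omega>) * indicator {\<theta> - u<..} (Y \<omega>)) \<partial>M) \<partial>lborel)"
      by (intro L.Fubini'[symmetric]) (simp add: greaterThan_def)
    also have "\<dots> = (\<integral>\<^sup>+u. indicator {a<..<b} u *
          ennreal (prob {\<omega> \<in> space M. u < X \<omega> \<and> \<theta> - u < Y \<omega>}) \<partial>lborel)"
      by (subst nn_integral_cmult) (auto simp: joint)
    finally show ?thesis
      unfolding J_def .
  qed
  have lhs: "(\<integral>\<^sup>+\<omega>. ennreal (X \<omega> + Y \<omega> - \<theta>) \<partial>M) = A + J"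
  proof -
    have "(\<integral>\<^sup>+\<omega>. ennreal (X \<omega> + Y \<omega> - \<theta>) \<partial>M)
        = (\<integral>\<^sup>+\<omega>. ennreal (a + Y \<omega> - \<theta>) + (\<integral>\<^sup>+u. indicator {a<..<b} u *
             (indicator {u<..} (X \<omega>) * indicator {\<theta> - u<..} (Y \<omega>)) \<partial>lborel) \<partial>M)"
      using bounds by (intro nn_integral_cong_AE, eventually_elim) (intro hinge_layer_cake, auto)
    also have "\<dots> = A + (\<integral>\<^sup>+\<omega>. (\<integral>\<^sup>+u. indicator {a<..<b} u *
             (indicator {u<..} (X \<omega>) * indicator {\<theta> - u<..} (Y \<omega>)) \<partial>lborel) \<partial>M)"
      unfolding A_def by (subst nn_integral_add) (auto simp: greaterThan_def)
    finally show ?thesis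
      unfolding fubini_joint .
  qed
  have rhs: "(\<integral>\<^sup>+\<omega>. (\<integral>\<^sup>+\<omega>'. ennreal (X \<omega> + Y \<omega>' - \<theta>) \<partial>M) \<partial>M) = A + P"
  proof -
    have "(\<integral>\<^sup>+\<omega>. (\<integral>\<^sup>+\<omega>'. ennreal (X \<omega> + Y \<omega>' - \<theta>) \<partial>M) \<partial>M)
      = (\<integral>\<^sup>+\<omega>. (\<integral>\<^sup>+\<omega>'. ennreal (a + Y \<omega>' - \<theta>) + (\<integral>\<^sup>+u. indicator {a<..<b} u *
           (indicator {u<..} (X \<omega>) * indicator {\<theta> - u<..} (Y \<omega>')) \<partial>lborel) \<partial>M) \<partial>M)"
      using bounds
      by (intro nn_integral_cong_AE, eventually_elim) (intro nn_integral_cong hinge_layer_cake, auto)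
    also have "\<dots> = (\<integral>\<^sup>+\<omega>. A + (\<integral>\<^sup>+\<omega>'. (\<integral>\<^sup>+u. indicator {a<..<b} u *
           (indicator {u<..} (X \<omega>) * indicator {\<theta> - u<..} (Y \<omega>')) \<partial>lborel) \<partial>M) \<partial>M)"
      unfolding A_def by (subst nn_integral_add) (auto simp: greaterThan_def)
    also have "\<dots> = (\<integral>\<^sup>+\<omega>. A + (\<integral>\<^sup>+u. (\<integral>\<^sup>+\<omega>'. indicator {a<..<b} u *
           (indicator {u<..} (X \<omega>) * indicator {\<theta> - u<..} (Y \<omega>')) \<partial>M) \<partial>lborel) \<partial>M)"
      by (subst L.Fubini'[symmetric]) (auto simp: greaterThan_def)
    also have "\<dots> = (\<integral>\<^sup>+\<omega>. A + (\<integral>\<^sup>+u. indicator {a<..<b} u *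
           ennreal (prob {\<omega> \<in> space M. \<theta> - u < Y \<omega>}) * indicator {u<..} (X \<omega>) \<partial>lborel) \<partial>M)"
    proof (intro nn_integral_cong arg_cong2[where f="(+)"] refl, goal_cases)
      case (1 \<omega> u)
      have "(\<integral>\<^sup>+\<omega>'. indicator {a<..<b} u * (indicator {u<..} (X \<omega>) * indicator {\<theta> - u<..} (Y \<omega>')) \<partial>M)
         = (\<integral>\<^sup>+\<omega>'. (indicator {a<..<b} u * indicator {u<..} (X \<omega>)) * indicator {\<theta> - u<..} (Y \<omega>') \<partial>M)"
        by (simp add: mult.assoc)
      also have "\<dots> = (indicator {a<..<b} u * indicator {u<..} (X \<omega>)) * ennreal (prob {\<omega> \<in> space M. \<theta> - u < Y \<omega>})"
        by (subst nn_integral_cmult) (auto simp: marg)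
      finally show ?case by (simp add: ac_simps)
    qed
    also have "\<dots> = A + (\<integral>\<^sup>+\<omega>. (\<integral>\<^sup>+u. indicator {a<..<b} u *
           ennreal (prob {\<omega> \<in> space M. \<theta> - u < Y \<omega>}) * indicator {u<..} (X \<omega>) \<partial>lborel) \<partial>M)"
      by (subst nn_integral_add) (auto simp: greaterThan_def emeasure_space_1)
    also have "(\<integral>\<^sup>+\<omega>. (\<integral>\<^sup>+u. indicator {a<..<b} u *
           ennreal (prob {\<omega> \<in> space M. \<theta> - u < Y \<omega>}) * indicator {u<..} (X \<omega>) \<partial>lborel) \<partial>M)
       = (\<integral>\<^sup>+u. (\<integral>\<^sup>+\<omega>. indicator {a<..<b} u *
           ennreal (prob {\<omega> \<in> space M. \<theta> - u < Y \<omega>}) * indicator {u<..} (X \<omega>) \<partial>M) \<partial>lborel)"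
      by (subst L.Fubini'[symmetric]) (auto simp: greaterThan_def)
    also have "\<dots> = (\<integral>\<^sup>+u. indicator {a<..<b} u *
        ennreal (prob {\<omega> \<in> space M. u < X \<omega>} * prob {\<omega> \<in> space M. \<theta> - u < Y \<omega>}) \<partial>lborel)"
      by (subst nn_integral_cmult) (auto simp: marg ennreal_mult ac_simps)
    finally show ?thesis
      unfolding P_def .
  qed
  have "J \<le> P + ennreal ((b - a) * \<alpha>)"
  proof -
    have "J \<le> (\<integral>\<^sup>+u. indicator {a<..<b} u *
          ennreal (prob {\<omega> \<in> space M. u < X \<omega>} * prob {\<omega> \<in> space M. \<theta> - u < Y \<omega>})
          + ennreal \<alpha> * indicator {a<..<b} u \<partial>lborel)"
      unfolding J_def
    proof (intro nn_integral_mono)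
      fix u :: real
      have "ennreal (prob {\<omega> \<in> space M. u < X \<omega> \<and> \<theta> - u < Y \<omega>})
         \<le> ennreal (prob {\<omega> \<in> space M. u < X \<omega>} * prob {\<omega> \<in> space M. \<theta> - u < Y \<omega>} + \<alpha>)"
        by (rule ennreal_leI[OF dep])
      also have "\<dots> = ennreal (prob {\<omega> \<in> space M. u < X \<omega>} * prob {\<omega> \<in> space M. \<theta> - u < Y \<omega>}) + ennreal \<alpha>"
        using \<open>\<alpha> \<ge> 0\<close> by (intro ennreal_plus) auto
      finally show "indicator {a<..<b} u * ennreal (prob {\<omega> \<in> space M. u < X \<omega> \<and> \<theta> - u < Y \<omega>})
         \<le> indicator {a<..<b} u *
             ennreal (prob {\<omega> \<in> space M. u < X \<omega>} * prob {\<omega> \<in> space M. \<theta> - u < Y \<omega>})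
           + ennreal \<alpha> * indicator {a<..<b} u"
        by (cases "u \<in> {a<..<b}") simp_all
    qed
    also have "\<dots> = P + ennreal ((b - a) * \<alpha>)"
    proof -
      have "(\<integral>\<^sup>+u. ennreal \<alpha> * indicator {a<..<b} u \<partial>lborel) = ennreal \<alpha> * emeasure lborel {a<..<b}"
        by (intro nn_integral_cmult_indicator) simp
      also have "emeasure lborel {a<..<b} = ennreal (b - a)"
        using \<open>a \<le> b\<close> by (rule emeasure_lborel_Ioo)
      also have "ennreal \<alpha> * ennreal (b - a) = ennreal (\<alpha> * (b - a))"
        using \<open>a \<le> b\<close> \<open>\<alpha> \<ge> 0\<close> by (intro ennreal_mult[symmetric]) auto
      finally have "(\<integral>\<^sup>+u. ennreal \<alpha> * indicator {a<..<b} u \<partial>lborel) = ennreal ((b - a) * \<alpha>)"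
        by (simp only: mult.commute)
      then show ?thesis
        unfolding P_def by (subst nn_integral_add) simp_all
    qed
    finally show ?thesis .
  qed
  then show ?thesis
    unfolding lhs rhs add.assoc by (rule add_left_mono)
qed

text \<open>
  The line of slope 1 tangent to $e^{hy}/(eh)$ passes through the origin.
\<close>

lemma hinge_le_exp:
  fixes h y :: real
  assumes "h > 0"
  shows "y \<le> exp (h * y) / (exp 1 * h)"
proof -
  have "h * y \<le> exp (h * y - 1)"
    using exp_ge_add_one_self[of "h * y - 1"] by simp
  then show ?thesis
    using assms by (simp add: exp_diff field_simps)
qed

text \<open>
  Induction from the last variable to the first. The claim for the remainder holds at every
  threshold, so after decoupling $Y_m$ it may be used at the random threshold $\theta - Y_m$; the
  exponential bound is then averaged over $Y_m$ by Hoeffding's lemma, while the accumulated mixing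
  error, which does not involve the threshold, passes through unchanged.
\<close>

lemma (in prob_space) hinge_sum_le:
  fixes Y :: "nat \<Rightarrow> 'a \<Rightarrow> real" and a b \<alpha> :: "nat \<Rightarrow> real"
  assumes meas: "\<And>i. m \<le> i \<Longrightarrow> i < N \<Longrightarrow> Y i \<in> borel_measurable M"
    and bounds: "\<And>i. m \<le> i \<Longrightarrow> i < N \<Longrightarrow> AE \<omega> in M. a i \<le> Y i \<omega> \<and> Y i \<omega> \<le> b i"
    and mean: "\<And>i. m \<le> i \<Longrightarrow> i < N \<Longrightarrow> expectation (Y i) = 0"
    and \<alpha>: "\<And>i. m \<le> i \<Longrightarrow> i < N \<Longrightarrow> \<alpha> i \<ge> 0"
    and dep: "\<And>i u v. m \<le> i \<Longrightarrow> i < N \<Longrightarrow>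
        prob {\<omega> \<in> space M. u < Y i \<omega> \<and> v < (\<Sum>l = Suc i..<N. Y l \<omega>)}
          \<le> prob {\<omega> \<in> space M. u < Y i \<omega>} * prob {\<omega> \<in> space M. v < (\<Sum>l = Suc i..<N. Y l \<omega>)} + \<alpha> i"
    and "h > 0" and "m \<le> N"
  shows "(\<integral>\<^sup>+\<omega>. ennreal ((\<Sum>i = m..<N. Y i \<omega>) - \<theta>) \<partial>M)
       \<le> ennreal (exp (- h * \<theta> + h\<^sup>2 / 8 * (\<Sum>i = m..<N. (b i - a i)\<^sup>2)) / (exp 1 * h)
                  + (\<Sum>i = m..<N. (b i - a i) * \<alpha> i))"
  using \<open>m \<le> N\<close>
proof (induction m arbitrary: \<theta> rule: inc_induct)
  case base
  show ?case
    using hinge_le_exp[OF \<open>h > 0\<close>, of "- \<theta>"] by (auto simp: emeasure_space_1 intro!: ennreal_leI)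
next
  case (step n)
  note [measurable] = meas
  define R where "R \<omega> = (\<Sum>i = Suc n..<N. Y i \<omega>)" for \<omega>
  define E where "E = exp (- h * \<theta> + h\<^sup>2 / 8 * (\<Sum>i = Suc n..<N. (b i - a i)\<^sup>2)) / (exp 1 * h)"
  define err where "err = (\<Sum>i = Suc n..<N. (b i - a i) * \<alpha> i)"
  have ab: "a i \<le> b i" if "m \<le> i" "i < N" for i
  proof -
    have "AE \<omega> in M. a i \<le> b i" using bounds[OF that] by eventually_elim auto
    then show ?thesis by simp
  qed
  have "err \<ge> 0"
    unfolding err_def using ab \<alpha> step.hyps by (intro sum_nonneg mult_nonneg_nonneg) auto
  have "E \<ge> 0" using \<open>h > 0\<close> by (simp add: E_def)
  have [measurable]: "Y n \<in> borel_measurable M" "R \<in> borel_measurable M"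
    unfolding R_def using step.hyps by (auto intro!: meas borel_measurable_sum)
  \<comment> \<open>Hoeffding's lemma for the mean-zero variable that is peeled off\<close>
  have mgf: "(\<integral>\<^sup>+\<omega>. ennreal (exp (h * Y n \<omega>)) \<partial>M) \<le> ennreal (exp (h\<^sup>2 * (b n - a n)\<^sup>2 / 8))"
  proof -
    interpret V: interval_bounded_random_variable M "Y n" "a n" "b n"
      using bounds[OF step.hyps] by unfold_locales auto
    show ?thesis
      by (rule V.Hoeffdings_lemma_nn_integral_0) (use \<open>h > 0\<close> mean step.hyps in auto)
  qed
  have "(\<integral>\<^sup>+\<omega>. ennreal ((\<Sum>i = n..<N. Y i \<omega>) - \<theta>) \<partial>M) = (\<integral>\<^sup>+\<omega>. ennreal (Y n \<omega> + R \<omega> - \<theta>) \<partial>M)"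
    using \<open>n < N\<close> by (simp add: R_def sum.atLeast_Suc_lessThan)
  also have "\<dots> \<le> (\<integral>\<^sup>+\<omega>. (\<integral>\<^sup>+\<omega>'. ennreal (Y n \<omega> + R \<omega>' - \<theta>) \<partial>M) \<partial>M) + ennreal ((b n - a n) * \<alpha> n)"
    using bounds \<alpha> dep step.hyps unfolding R_def[symmetric]
    by (intro hinge_decouple) (auto simp: R_def)
  also have "(\<integral>\<^sup>+\<omega>. (\<integral>\<^sup>+\<omega>'. ennreal (Y n \<omega> + R \<omega>' - \<theta>) \<partial>M) \<partial>M)
      \<le> (\<integral>\<^sup>+\<omega>. ennreal E * ennreal (exp (h * Y n \<omega>)) + ennreal err \<partial>M)"
  proof (intro nn_integral_mono)
    fix \<omega>
    have "(\<integral>\<^sup>+\<omega>'. ennreal (Y n \<omega> + R \<omega>' - \<theta>) \<partial>M) = (\<integral>\<^sup>+\<omega>'. ennreal (R \<omega>' - (\<theta> - Y n \<omega>)) \<partial>M)"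
      by (simp add: algebra_simps)
    also have "\<dots> \<le> ennreal (exp (- h * (\<theta> - Y n \<omega>)
           + h\<^sup>2 / 8 * (\<Sum>i = Suc n..<N. (b i - a i)\<^sup>2)) / (exp 1 * h) + err)"
      unfolding R_def err_def by (rule step.IH)
    also have "exp (- h * (\<theta> - Y n \<omega>) + h\<^sup>2 / 8 * (\<Sum>i = Suc n..<N. (b i - a i)\<^sup>2)) / (exp 1 * h)
        = E * exp (h * Y n \<omega>)"
      unfolding E_def by (simp add: exp_add[symmetric] algebra_simps)
    finally show "(\<integral>\<^sup>+\<omega>'. ennreal (Y n \<omega> + R \<omega>' - \<theta>) \<partial>M)
        \<le> ennreal E * ennreal (exp (h * Y n \<omega>)) + ennreal err"
      using \<open>E \<ge> 0\<close> \<open>err \<ge> 0\<close> by (simp add: ennreal_plus ennreal_mult)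
  qed
  also have "\<dots> = ennreal E * (\<integral>\<^sup>+\<omega>. ennreal (exp (h * Y n \<omega>)) \<partial>M) + ennreal err"
    by (simp add: nn_integral_add nn_integral_cmult emeasure_space_1)
  also have "\<dots> \<le> ennreal E * ennreal (exp (h\<^sup>2 * (b n - a n)\<^sup>2 / 8)) + ennreal err"
    by (intro add_mono mult_left_mono mgf) auto
  also have "\<dots> + ennreal ((b n - a n) * \<alpha> n)
      = ennreal (E * exp (h\<^sup>2 * (b n - a n)\<^sup>2 / 8) + ((b n - a n) * \<alpha> n + err))"
    using \<open>E \<ge> 0\<close> \<open>err \<ge> 0\<close> ab[OF step.hyps] \<alpha>[OF step.hyps]
    by (simp add: ennreal_plus ennreal_mult ac_simps)
  also have "E * exp (h\<^sup>2 * (b n - a n)\<^sup>2 / 8)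
      = exp (- h * \<theta> + h\<^sup>2 / 8 * (\<Sum>i = n..<N. (b i - a i)\<^sup>2)) / (exp 1 * h)"
    using \<open>n < N\<close> unfolding E_def
    by (simp add: exp_add[symmetric] sum.atLeast_Suc_lessThan algebra_simps)
  also have "(b n - a n) * \<alpha> n + err = (\<Sum>i = n..<N. (b i - a i) * \<alpha> i)"
    using \<open>n < N\<close> by (simp add: err_def sum.atLeast_Suc_lessThan)
  finally show ?case
    by (simp add: add_right_mono)
qed

section \<open>Mixing coefficients of generated events and separating orderings\<close>

lemma (in prob_space) abs_dependence_le_1: "\<bar>prob (B \<inter> C) - prob B * prob C\<bar> \<le> 1"
proof -
  have "0 \<le> prob B * prob C" "prob B * prob C \<le> 1"
    by (auto intro: mult_le_one)
  then show ?thesis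
    using prob_le_1[of "B \<inter> C"] measure_nonneg[of M "B \<inter> C"] by linarith
qed

lemma (in prob_space) abs_dependence_le_alpha_mixing:
  assumes "B \<in> \<B>" "C \<in> \<C>"
  shows "\<bar>prob (B \<inter> C) - prob B * prob C\<bar> \<le> alpha_mixing M \<B> \<C>"
proof -
  have "bdd_above ((\<lambda>(B, C). \<bar>prob (B \<inter> C) - prob B * prob C\<bar>) ` (\<B> \<times> \<C>))"
    using abs_dependence_le_1 by (intro bdd_aboveI2[where M = 1]) auto
  from cSUP_upper[OF _ this, of "(B, C)"] show ?thesis
    using assms by (simp add: alpha_mixing_def)
qed

lemma generated_events_eq_sets:
  "generated_events M X J =
     sets (sigma (space M) {X j -` A \<inter> space M | j A. j \<in> J \<and> A \<in> sets borel})"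
  unfolding generated_events_def by (subst sets_measure_of) auto

lemma measurable_generated_events:
  fixes X :: "'i \<Rightarrow> 'a \<Rightarrow> real"
  assumes "j \<in> J"
  shows "X j \<in> borel_measurable
     (sigma (space M) {X j -` A \<inter> space M | j A. j \<in> J \<and> A \<in> sets borel})"
proof (rule measurableI)
  fix A :: "real set" assume "A \<in> sets borel"
  then have "X j -` A \<inter> space M \<in> {X j -` A \<inter> space M | j A. j \<in> J \<and> A \<in> sets borel}"
    using assms by blast
  then show "X j -` A \<inter> space (sigma (space M) {X j -` A \<inter> space M | j A. j \<in> J \<and> A \<in> sets borel})
     \<in> sets (sigma (space M) {X j -` A \<inter> space M | j A. j \<in> J \<and> A \<in> sets borel})"
    by (subst sets_measure_of) (auto simp: space_measure_of_conv)
qed simp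

lemma superlevel_set_in_generated_events:
  fixes f :: "'i \<Rightarrow> real \<Rightarrow> real"
  assumes "\<And>j. j \<in> J \<Longrightarrow> f j \<in> borel_measurable borel"
  shows "{\<omega> \<in> space M. v < (\<Sum>j\<in>J. f j (X j \<omega>))} \<in> generated_events M X J"
proof -
  let ?N = "sigma (space M) {X j -` A \<inter> space M | j A. j \<in> J \<and> A \<in> sets borel}"
  have "(\<lambda>\<omega>. \<Sum>j\<in>J. f j (X j \<omega>)) \<in> borel_measurable ?N"
    using assms
    by (intro borel_measurable_sum measurable_compose[OF measurable_generated_events]) auto
  then have "{\<omega> \<in> space ?N. v < (\<Sum>j\<in>J. f j (X j \<omega>))} \<in> sets ?N"
    by measurable
  then show ?thesis
    by (simp add: generated_events_eq_sets space_measure_of_conv)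
qed

lemma (in prob_space) alpha_mixing_generated_nonneg:
  "0 \<le> alpha_mixing M (generated_events M X J) (generated_events M X K)"
proof -
  have "{} \<in> generated_events M X L" for L
    unfolding generated_events_def by (rule sigma_sets.Empty)
  from abs_dependence_le_alpha_mixing[OF this this] show ?thesis
    by (rule order_trans[rotated]) simp
qed

text \<open>
  The last variable of an ordering has nothing after it, and its coefficient is absent from the
  definition of the separation coefficient. This lemma allows the sum to include it.
\<close>

lemma (in prob_space) alpha_mixing_generated_empty:
  "alpha_mixing M (generated_events M X J) (generated_events M X {}) = 0"
proof (rule antisym[OF _ alpha_mixing_generated_nonneg])
  have sub: "B \<inter> space M = B" if "B \<in> generated_events M X J" for B
    using that sets.sets_into_space unfolding generated_events_eq_sets
    by (fastforce simp: space_measure_of_conv)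
  have triv: "generated_events M X {} = {{}, space M}"
    by (simp add: generated_events_def sigma_sets_empty_eq)
  have "generated_events M X J \<noteq> {}"
    unfolding generated_events_eq_sets using sets.empty_sets by blast
  then show "alpha_mixing M (generated_events M X J) (generated_events M X {}) \<le> 0"
    unfolding alpha_mixing_def triv
    by (intro cSUP_least) (auto simp: sub prob_space)
qed

lemma gamma_independentE:
  assumes "gamma_independent M X \<gamma> I" "finite I"
  obtains \<pi> where "bij_betw \<pi> {1..card I} I"
    and "(\<Sum>i = 1..<card I. alpha_mixing M (generated_events M X {\<pi> i})
            (generated_events M X (\<pi> ` {i+1..card I}))) \<le> real (card I) * \<gamma>"
proof -
  define orders where "orders = {\<pi> \<in> {1..card I} \<rightarrow>\<^sub>E I. bij_betw \<pi> {1..card I} I}"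
  define s where "s \<pi> = (\<Sum>i = 1..<card I. alpha_mixing M (generated_events M X {\<pi> i})
            (generated_events M X (\<pi> ` {i+1..card I})))" for \<pi>
  have "finite orders"
    unfolding orders_def using \<open>finite I\<close> by (intro finite_subset[OF Collect_restrict finite_PiE]) auto
  moreover have "orders \<noteq> {}"
  proof -
    obtain p where p: "bij_betw p {1..card I} I"
      using finite_same_card_bij[of "{1..card I}" I] \<open>finite I\<close> by auto
    then have "bij_betw (restrict p {1..card I}) {1..card I} I"
      by (rule iffD1[OF bij_betw_cong, rotated]) simp
    then have "restrict p {1..card I} \<in> orders"
      using p by (auto simp: orders_def bij_betw_def)
    then show ?thesis by blast
  qed
  ultimately have "alpha_separation M X I \<in> (\<lambda>\<pi>. 1 / real (card I) * s \<pi>) ` orders"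
    unfolding alpha_separation_def Let_def orders_def[symmetric] s_def[symmetric]
    by (intro Min_in) auto
  then obtain \<pi> where "\<pi> \<in> orders" and eq: "alpha_separation M X I = 1 / real (card I) * s \<pi>"
    by blast
  have "s \<pi> \<le> real (card I) * \<gamma>"
  proof (cases "card I = 0")
    case False
    then show ?thesis
      using assms(1) eq by (simp add: gamma_independent_def field_simps)
  qed (simp add: s_def)
  with \<open>\<pi> \<in> orders\<close> show ?thesis
    using that by (auto simp: orders_def s_def)
qed

text \<open>
  The singletons form a soft cover, so the least size of a soft cover is not a \<open>LEAST\<close> over an
  empty set.
\<close>

lemma (in prob_space) soft_chromatic_attained:
  assumes "\<gamma> \<ge> 0"
  obtains \<J> where "soft_cover M X n \<gamma> \<J>" "card \<J> = soft_chromatic M X n \<gamma>"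
proof -
  have single: "gamma_independent M X \<gamma> {i}" for i
  proof -
    let ?B = "{\<pi> \<in> {1..card {i}} \<rightarrow>\<^sub>E {i}. bij_betw \<pi> {1..card {i}} {i}}"
    have "(\<lambda>k\<in>{1..card {i}}. i) \<in> ?B"
      by (auto simp: bij_betw_def inj_on_def)
    then have ne: "?B \<noteq> {}" by blast
    have "alpha_separation M X {i} = Min ((\<lambda>\<pi>. 0) ` ?B)"
      unfolding alpha_separation_def Let_def by (rule arg_cong[where f = Min], rule image_cong) auto
    also have "\<dots> = 0"
      using ne by (simp only: image_constant_conv if_False) simp
    finally show ?thesis
      using assms by (simp add: gamma_independent_def)
  qed
  have "soft_cover M X n \<gamma> ((\<lambda>i. {i}) ` {1..n})"
    by (auto simp: soft_cover_def single)
  then have "\<exists>m \<J>. soft_cover M X n \<gamma> \<J> \<and> card \<J> = m"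
    by blast
  from LeastI_ex[OF this] show ?thesis
    using that unfolding soft_chromatic_def by blast
qed

section \<open>The tail of a softly covered sum\<close>

text \<open>
  The variables of \<open>I\<close> outside \<open>A\<close> are kept in the ordering as constants 0: a subset of a
  $\gamma$-independent set need not be $\gamma$-independent, because the separation coefficient is
  normalised by the size of the set. Constants have width 0, so only widths of indices in \<open>A\<close> enter
  the error, and each of these is at most $\sqrt{v}$ for $v = \sum_{i \in A} (b_i - a_i)^2$.
\<close>

lemma (in prob_space) gamma_independent_hinge_le:
  fixes X :: "'i \<Rightarrow> 'a \<Rightarrow> real" and a b :: "'i \<Rightarrow> real"
  assumes "finite I" "A \<subseteq> I"
    and meas: "\<And>i. i \<in> I \<Longrightarrow> X i \<in> borel_measurable M"
    and bounds: "\<And>i. i \<in> I \<Longrightarrow> AE \<omega> in M. a i \<le> X i \<omega> \<and> X i \<omega> \<le> b i"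
    and "gamma_independent M X \<gamma> I" and "h > 0"
  shows "(\<integral>\<^sup>+\<omega>. ennreal ((\<Sum>i\<in>A. X i \<omega> - expectation (X i)) - \<theta>) \<partial>M)
       \<le> ennreal (exp (- h * \<theta> + h\<^sup>2 / 8 * (\<Sum>i\<in>A. (b i - a i)\<^sup>2)) / (exp 1 * h)
                  + real (card I) * \<gamma> * sqrt (\<Sum>i\<in>A. (b i - a i)\<^sup>2))"
proof -
  define k where "k = card I"
  define v where "v = (\<Sum>i\<in>A. (b i - a i)\<^sup>2)"
  obtain \<pi> where bij: "bij_betw \<pi> {1..k} I"
    and sep: "(\<Sum>i = 1..<k. alpha_mixing M (generated_events M X {\<pi> i})
            (generated_events M X (\<pi> ` {i+1..k}))) \<le> real k * \<gamma>"
    using gamma_independentE[OF \<open>gamma_independent M X \<gamma> I\<close> \<open>finite I\<close>] unfolding k_def by blast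
  have \<pi>: "\<pi> i \<in> I" if "1 \<le> i" "i < Suc k" for i
    using bij that by (auto simp: bij_betw_def)
  \<comment> \<open>centering on \<open>A\<close>, and 0 on the other indices\<close>
  define f where "f j x = (if j \<in> A then x - expectation (X j) else 0)" for j and x :: real
  define Y where "Y i \<omega> = f (\<pi> i) (X (\<pi> i) \<omega>)" for i \<omega>
  define \<alpha> where "\<alpha> i = alpha_mixing M (generated_events M X {\<pi> i})
      (generated_events M X (\<pi> ` {Suc i..<Suc k}))" for i
  have f_meas [measurable]: "f j \<in> borel_measurable borel" for j
    unfolding f_def by (cases "j \<in> A") simp_all
  have reindex: "(\<Sum>i = 1..<Suc k. if \<pi> i \<in> A then g (\<pi> i) else 0) = (\<Sum>j\<in>A. g j)"
    for g :: "'i \<Rightarrow> real"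
  proof -
    have "(\<Sum>i = 1..<Suc k. if \<pi> i \<in> A then g (\<pi> i) else 0) = (\<Sum>j\<in>I. if j \<in> A then g j else 0)"
      using sum.reindex_bij_betw[OF bij, of "\<lambda>j. if j \<in> A then g j else 0"]
      by (simp add: atLeastLessThanSuc_atLeastAtMost)
    also have "\<dots> = (\<Sum>j\<in>A. g j)"
      using \<open>A \<subseteq> I\<close> \<open>finite I\<close> by (simp add: sum.If_cases Int_absorb1)
    finally show ?thesis .
  qed
  have width_le: "(if \<pi> i \<in> A then b (\<pi> i) - a (\<pi> i) else 0) \<le> sqrt v" for i
  proof (cases "\<pi> i \<in> A")
    case True
    have "(b (\<pi> i) - a (\<pi> i))\<^sup>2 \<le> v"
      unfolding v_def using True finite_subset[OF \<open>A \<subseteq> I\<close> \<open>finite I\<close>]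
      by (intro member_le_sum) auto
    then show ?thesis
      using True by (simp add: real_le_rsqrt)
  qed (simp add: v_def sum_nonneg)
  have \<alpha>_sum: "(\<Sum>i = 1..<Suc k. \<alpha> i) \<le> real k * \<gamma>"
  proof (cases "k = 0")
    case False
    then have "(\<Sum>i = 1..<Suc k. \<alpha> i) = (\<Sum>i = 1..<k. \<alpha> i)"
      by (simp add: \<alpha>_def alpha_mixing_generated_empty)
    also have "\<dots> \<le> real k * \<gamma>"
      using sep by (simp add: \<alpha>_def atLeastLessThanSuc_atLeastAtMost)
    finally show ?thesis .
  qed simp
  have tail_sum: "(\<Sum>l = Suc i..<Suc k. Y l \<omega>) = (\<Sum>j\<in>\<pi> ` {Suc i..<Suc k}. f j (X j \<omega>))" for i \<omega>
  proof -
    have "inj_on \<pi> {Suc i..<Suc k}"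
      using bij by (auto simp: bij_betw_def intro: inj_on_subset)
    then show ?thesis by (simp add: sum.reindex Y_def)
  qed
  have "(\<integral>\<^sup>+\<omega>. ennreal ((\<Sum>i = 1..<Suc k. Y i \<omega>) - \<theta>) \<partial>M)
       \<le> ennreal (exp (- h * \<theta> + h\<^sup>2 / 8 * (\<Sum>i = 1..<Suc k.
            ((if \<pi> i \<in> A then b (\<pi> i) - expectation (X (\<pi> i)) else 0)
           - (if \<pi> i \<in> A then a (\<pi> i) - expectation (X (\<pi> i)) else 0))\<^sup>2)) / (exp 1 * h)
                  + (\<Sum>i = 1..<Suc k. ((if \<pi> i \<in> A then b (\<pi> i) - expectation (X (\<pi> i)) else 0)
           - (if \<pi> i \<in> A then a (\<pi> i) - expectation (X (\<pi> i)) else 0)) * \<alpha> i))"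
  proof (rule hinge_sum_le)
    fix i assume i: "1 \<le> i" "i < Suc k"
    note [measurable] = meas[OF \<pi>[OF i]]
    show "Y i \<in> borel_measurable M"
      unfolding Y_def by measurable
    show "AE \<omega> in M. (if \<pi> i \<in> A then a (\<pi> i) - expectation (X (\<pi> i)) else 0) \<le> Y i \<omega>
        \<and> Y i \<omega> \<le> (if \<pi> i \<in> A then b (\<pi> i) - expectation (X (\<pi> i)) else 0)"
      using bounds[OF \<pi>[OF i]] by eventually_elim (auto simp: Y_def f_def)
    interpret V: interval_bounded_random_variable M "X (\<pi> i)" "a (\<pi> i)" "b (\<pi> i)"
      using bounds[OF \<pi>[OF i]] by unfold_locales auto
    show "expectation (Y i) = 0"
      using V.expectation_shift by (cases "\<pi> i \<in> A") (simp_all add: Y_def[abs_def] f_def)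
    show "\<alpha> i \<ge> 0"
      unfolding \<alpha>_def by (rule alpha_mixing_generated_nonneg)
    fix u v
    let ?B = "{\<omega> \<in> space M. u < Y i \<omega>}"
    let ?C = "{\<omega> \<in> space M. v < (\<Sum>l = Suc i..<Suc k. Y l \<omega>)}"
    have "?B \<in> generated_events M X {\<pi> i}"
      using superlevel_set_in_generated_events[of "{\<pi> i}" f M u X] by (simp add: Y_def)
    moreover have "?C \<in> generated_events M X (\<pi> ` {Suc i..<Suc k})"
      unfolding tail_sum by (rule superlevel_set_in_generated_events) simp
    ultimately have "\<bar>prob (?B \<inter> ?C) - prob ?B * prob ?C\<bar> \<le> \<alpha> i"
      unfolding \<alpha>_def by (rule abs_dependence_le_alpha_mixing)
    moreover have "?B \<inter> ?C = {\<omega> \<in> space M. u < Y i \<omega> \<and> v < (\<Sum>l = Suc i..<Suc k. Y l \<omega>)}"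
      by auto
    ultimately have "\<bar>prob {\<omega> \<in> space M. u < Y i \<omega> \<and> v < (\<Sum>l = Suc i..<Suc k. Y l \<omega>)}
        - prob ?B * prob ?C\<bar> \<le> \<alpha> i"
      by (simp only:)
    then show "prob {\<omega> \<in> space M. u < Y i \<omega> \<and> v < (\<Sum>l = Suc i..<Suc k. Y l \<omega>)}
        \<le> prob ?B * prob ?C + \<alpha> i"
      by linarith
  qed (use \<open>h > 0\<close> in auto)
  also have "(\<Sum>i = 1..<Suc k. ((if \<pi> i \<in> A then b (\<pi> i) - expectation (X (\<pi> i)) else 0)
           - (if \<pi> i \<in> A then a (\<pi> i) - expectation (X (\<pi> i)) else 0))\<^sup>2) = v"
    unfolding v_def by (subst reindex[symmetric]) (intro sum.cong, auto)
  also have "(\<Sum>i = 1..<Suc k. ((if \<pi> i \<in> A then b (\<pi> i) - expectation (X (\<pi> i)) else 0)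
           - (if \<pi> i \<in> A then a (\<pi> i) - expectation (X (\<pi> i)) else 0)) * \<alpha> i)
      \<le> (\<Sum>i = 1..<Suc k. sqrt v * \<alpha> i)"
  proof (intro sum_mono mult_right_mono)
    fix i
    show "(if \<pi> i \<in> A then b (\<pi> i) - expectation (X (\<pi> i)) else 0)
           - (if \<pi> i \<in> A then a (\<pi> i) - expectation (X (\<pi> i)) else 0) \<le> sqrt v"
      using width_le[of i] by (auto split: if_splits)
  qed (simp add: \<alpha>_def alpha_mixing_generated_nonneg)
  also have "\<dots> = (\<Sum>i = 1..<Suc k. \<alpha> i) * sqrt v"
    by (subst mult.commute) (rule sum_distrib_left[symmetric])
  also have "\<dots> \<le> real k * \<gamma> * sqrt v"
    using \<alpha>_sum by (intro mult_right_mono) (auto simp: v_def sum_nonneg)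
  also have "(\<lambda>\<omega>. \<Sum>i = 1..<Suc k. Y i \<omega>) = (\<lambda>\<omega>. \<Sum>i\<in>A. X i \<omega> - expectation (X i))"
    by (subst reindex[symmetric]) (auto simp: Y_def f_def fun_eq_iff intro!: sum.cong)
  finally show ?thesis
    by (simp add: v_def k_def ennreal_leI add_left_mono)
qed

lemma ennreal_sum_le: "ennreal (\<Sum>i\<in>A. f i) \<le> (\<Sum>i\<in>A. ennreal (f i))"
proof (induction A rule: infinite_finite_induct)
  case (insert i A)
  have "ennreal (f i + sum f A) \<le> ennreal (f i) + ennreal (sum f A)"
  proof (cases "f i \<ge> 0 \<and> sum f A \<ge> 0")
    case False
    then show ?thesis
      by (auto simp: not_le ennreal_neg intro!: ennreal_leI)
  qed (simp add: ennreal_plus)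
  also have "\<dots> \<le> ennreal (f i) + (\<Sum>i\<in>A. ennreal (f i))"
    by (intro add_left_mono insert.IH)
  finally show ?case using insert.hyps by simp
qed simp_all

lemma (in prob_space) centered_le_width:
  fixes X :: "'a \<Rightarrow> real"
  assumes "X \<in> borel_measurable M" "AE \<omega> in M. a \<le> X \<omega> \<and> X \<omega> \<le> b"
  shows "AE \<omega> in M. X \<omega> - expectation X \<le> b - a"
proof -
  interpret V: interval_bounded_random_variable M X a b
    using assms by unfold_locales auto
  have "a \<le> expectation X"
    using assms by (intro integral_ge_const) auto
  then show ?thesis
    using assms(2) by auto
qed

text \<open>
  Hinges are subadditive, so for weights $p_J$ with sum 1 the hinge of $S$ at $\theta$ is at most the
  sum of the hinges of the group sums $S_J$ at $p_J \theta$. Taking $p_J$ proportional to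
  $\sqrt{v_J}$ and the exponent $h / p_J$ in group \<open>J\<close> makes the exponential factor the same in all
  groups, as in the optimal use of Hoelder's inequality for dependent groups.
\<close>

lemma (in prob_space) soft_cover_tail:
  fixes X :: "nat \<Rightarrow> 'a \<Rightarrow> real" and a b :: "nat \<Rightarrow> real"
  assumes cover: "soft_cover M X n \<gamma> \<J>"
    and meas: "\<And>i. i \<in> {1..n} \<Longrightarrow> X i \<in> borel_measurable M"
    and bounds: "\<And>i. i \<in> {1..n} \<Longrightarrow> AE \<omega> in M. a i \<le> X i \<omega> \<and> X i \<omega> \<le> b i"
    and "\<gamma> \<ge> 0" and nondeg: "(\<Sum>i = 1..n. (b i - a i)\<^sup>2) \<noteq> 0"
  obtains W where "W > 0" and "W\<^sup>2 \<le> real (card \<J>) * (\<Sum>i = 1..n. (b i - a i)\<^sup>2)"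
    and "\<And>L h s. L > 0 \<Longrightarrow> h > 0 \<Longrightarrow>
       prob {\<omega> \<in> space M. s < (\<Sum>i = 1..n. X i \<omega> - expectation (X i))}
         \<le> L / (exp 1 * h) * exp (- h * (s - 1 / L) + h\<^sup>2 * W\<^sup>2 / 8) + L * W * (real n * \<gamma>)"
proof -
  have sub: "\<J> \<subseteq> Pow {1..n}" and Un: "\<Union>\<J> = {1..n}"
    and ind: "\<And>J. J \<in> \<J> \<Longrightarrow> gamma_independent M X \<gamma> J"
    using cover by (auto simp: soft_cover_def)
  have "finite \<J>"
    using sub by (rule finite_subset) simp
  \<comment> \<open>each index is charged to a single set of the cover\<close>
  define asg where "asg i = (SOME J. J \<in> \<J> \<and> i \<in> J)" for i
  have asg: "asg i \<in> \<J>" "i \<in> asg i" if "i \<in> {1..n}" for i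
  proof -
    have "\<exists>J. J \<in> \<J> \<and> i \<in> J"
      using that Un by blast
    from someI_ex[OF this] show "asg i \<in> \<J>" "i \<in> asg i"
      by (auto simp: asg_def)
  qed
  define part where "part J = {i \<in> {1..n}. asg i = J}" for J
  have part_sub: "part J \<subseteq> J" for J
    using asg by (auto simp: part_def)
  have regroup: "(\<Sum>J\<in>\<J>. \<Sum>i\<in>part J. g i) = (\<Sum>i = 1..n. g i)" for g :: "nat \<Rightarrow> real"
    unfolding part_def using \<open>finite \<J>\<close> asg by (intro sum.group) auto
  define v where "v J = (\<Sum>i\<in>part J. (b i - a i)\<^sup>2)" for J
  have v_nonneg: "v J \<ge> 0" for J
    by (simp add: v_def sum_nonneg)
  define W where "W = (\<Sum>J\<in>\<J>. sqrt (v J))"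
  have v_sum: "(\<Sum>J\<in>\<J>. v J) = (\<Sum>i = 1..n. (b i - a i)\<^sup>2)"
    unfolding v_def by (rule regroup)
  have "W \<ge> 0"
    unfolding W_def by (intro sum_nonneg) (simp add: v_nonneg)
  moreover have "W \<noteq> 0"
  proof
    assume "W = 0"
    then have "\<forall>J\<in>\<J>. sqrt (v J) = 0"
      unfolding W_def using \<open>finite \<J>\<close> by (subst (asm) sum_nonneg_eq_0_iff) (auto simp: v_nonneg)
    then show False
      using nondeg v_sum by simp
  qed
  ultimately have "W > 0" by simp
  have W_le: "W\<^sup>2 \<le> real (card \<J>) * (\<Sum>i = 1..n. (b i - a i)\<^sup>2)"
    using Cauchy_Schwarz_ineq_sum[of "\<lambda>_. 1" "\<lambda>J. sqrt (v J)" \<J>]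
    by (simp add: W_def v_nonneg v_sum)
  define S where "S \<omega> = (\<Sum>i = 1..n. X i \<omega> - expectation (X i))" for \<omega>
  have [measurable]: "S \<in> borel_measurable M"
    unfolding S_def using meas by (intro borel_measurable_sum) auto
  define SJ where "SJ J \<omega> = (\<Sum>i\<in>part J. X i \<omega> - expectation (X i))" for J \<omega>
  have [measurable]: "SJ J \<in> borel_measurable M" for J
    unfolding SJ_def part_def using meas by (intro borel_measurable_sum) auto
  define p where "p J = sqrt (v J) / W" for J
  have p_sum: "(\<Sum>J\<in>\<J>. p J) = 1"
    using \<open>W > 0\<close> by (simp add: p_def W_def flip: sum_divide_distrib)
  have p_nonneg: "p J \<ge> 0" for J
    using \<open>W > 0\<close> by (simp add: p_def v_nonneg)
  have group: "(\<integral>\<^sup>+\<omega>. ennreal (SJ J \<omega> - p J * \<theta>) \<partial>M)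
      \<le> ennreal (p J * (exp (- h * \<theta> + h\<^sup>2 * W\<^sup>2 / 8) / (exp 1 * h)) + real n * \<gamma> * sqrt (v J))"
    if "J \<in> \<J>" "h > 0" for J h \<theta>
  proof (cases "v J = 0")
    case True
    have fin: "finite (part J)" by (simp add: part_def)
    have width0: "b i - a i = 0" if "i \<in> part J" for i
      using True that fin by (simp add: v_def sum_nonneg_eq_0_iff)
    \<comment> \<open>all variables of the group are almost surely constant, and the weight of the group is 0\<close>
    have "AE \<omega> in M. \<forall>i\<in>part J. X i \<omega> - expectation (X i) \<le> 0"
    proof (rule AE_finite_allI[OF fin])
      fix i assume i: "i \<in> part J"
      then have "i \<in> {1..n}" by (simp add: part_def)
      from centered_le_width[OF meas[OF this] bounds[OF this]]
      show "AE \<omega> in M. X i \<omega> - expectation (X i) \<le> 0"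
        using width0[OF i] by simp
    qed
    then have "AE \<omega> in M. ennreal (SJ J \<omega> - p J * \<theta>) = 0"
      by eventually_elim (simp add: p_def True SJ_def sum_nonpos ennreal_neg)
    then have "(\<integral>\<^sup>+\<omega>. ennreal (SJ J \<omega> - p J * \<theta>) \<partial>M) = (\<integral>\<^sup>+\<omega>. 0 \<partial>M)"
      by (rule nn_integral_cong_AE)
    then show ?thesis by simp
  next
    case False
    then have "v J > 0" using v_nonneg[of J] by simp
    then have "p J > 0" using \<open>W > 0\<close> by (simp add: p_def)
    have "J \<subseteq> {1..n}" using sub \<open>J \<in> \<J>\<close> by auto
    have "card J \<le> n"
      using card_mono[OF _ \<open>J \<subseteq> {1..n}\<close>] by simp
    have "(\<integral>\<^sup>+\<omega>. ennreal (SJ J \<omega> - p J * \<theta>) \<partial>M)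
      \<le> ennreal (exp (- (h / p J) * (p J * \<theta>) + (h / p J)\<^sup>2 / 8 * v J) / (exp 1 * (h / p J))
                  + real (card J) * \<gamma> * sqrt (v J))"
      unfolding SJ_def v_def
      using \<open>J \<subseteq> {1..n}\<close> \<open>p J > 0\<close> \<open>h > 0\<close> part_sub ind[OF \<open>J \<in> \<J>\<close>]
      by (intro gamma_independent_hinge_le meas bounds) (auto intro: finite_subset)
    also have "exp (- (h / p J) * (p J * \<theta>) + (h / p J)\<^sup>2 / 8 * v J) / (exp 1 * (h / p J))
        = p J * (exp (- h * \<theta> + h\<^sup>2 * W\<^sup>2 / 8) / (exp 1 * h))"
    proof -
      have "(h / p J)\<^sup>2 / 8 * v J = h\<^sup>2 * W\<^sup>2 / 8"
        using \<open>v J > 0\<close> \<open>W > 0\<close> by (simp add: p_def power_divide power_mult_distrib)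
      moreover have "- (h / p J) * (p J * \<theta>) = - h * \<theta>"
        using \<open>p J > 0\<close> by simp
      ultimately show ?thesis using \<open>p J > 0\<close> \<open>h > 0\<close> by simp
    qed
    also have "ennreal (\<dots> + real (card J) * \<gamma> * sqrt (v J)) \<le> ennreal (\<dots> + real n * \<gamma> * sqrt (v J))"
      using \<open>card J \<le> n\<close> \<open>\<gamma> \<ge> 0\<close> v_nonneg
      by (intro ennreal_leI add_left_mono mult_right_mono) auto
    finally show ?thesis .
  qed
  have tail: "prob {\<omega> \<in> space M. s < S \<omega>}
      \<le> L / (exp 1 * h) * exp (- h * (s - 1 / L) + h\<^sup>2 * W\<^sup>2 / 8) + L * W * (real n * \<gamma>)"
    if "L > 0" "h > 0" for L h s
  proof -
    define \<theta> where "\<theta> = s - 1 / L"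
    define E where "E = exp (- h * \<theta> + h\<^sup>2 * W\<^sup>2 / 8) / (exp 1 * h)"
    have "E \<ge> 0" using \<open>h > 0\<close> by (simp add: E_def)
    \<comment> \<open>the slope \<open>L\<close> and the kink \<open>s - 1 / L\<close> make the hinge equal to 1 at \<open>s\<close>\<close>
    have "ennreal (prob {\<omega> \<in> space M. s < S \<omega>}) = (\<integral>\<^sup>+\<omega>. indicator {\<omega> \<in> space M. s < S \<omega>} \<omega> \<partial>M)"
      by (simp add: emeasure_eq_measure)
    also have "\<dots> \<le> (\<integral>\<^sup>+\<omega>. ennreal L * ennreal (S \<omega> - \<theta>) \<partial>M)"
    proof (intro nn_integral_mono)
      fix \<omega>
      have "ennreal 1 \<le> ennreal (L * (S \<omega> - \<theta>))" if "s < S \<omega>"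
        using that \<open>L > 0\<close> by (intro ennreal_leI) (simp add: \<theta>_def algebra_simps)
      then show "indicator {\<omega> \<in> space M. s < S \<omega>} \<omega> \<le> ennreal L * ennreal (S \<omega> - \<theta>)"
        using \<open>L > 0\<close> by (auto simp: indicator_def ennreal_mult')
    qed
    also have "\<dots> \<le> (\<integral>\<^sup>+\<omega>. ennreal L * (\<Sum>J\<in>\<J>. ennreal (SJ J \<omega> - p J * \<theta>)) \<partial>M)"
    proof (intro nn_integral_mono mult_left_mono)
      fix \<omega>
      have "S \<omega> - \<theta> = (\<Sum>J\<in>\<J>. SJ J \<omega> - p J * \<theta>)"
        using regroup[of "\<lambda>i. X i \<omega> - expectation (X i)"] p_sum
        by (simp add: S_def SJ_def sum_subtractf flip: sum_distrib_right)
      then show "ennreal (S \<omega> - \<theta>) \<le> (\<Sum>J\<in>\<J>. ennreal (SJ J \<omega> - p J * \<theta>))"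
        using ennreal_sum_le by simp
    qed simp
    also have "\<dots> = ennreal L * (\<Sum>J\<in>\<J>. \<integral>\<^sup>+\<omega>. ennreal (SJ J \<omega> - p J * \<theta>) \<partial>M)"
      by (simp add: nn_integral_cmult nn_integral_sum)
    also have "\<dots> \<le> ennreal L * (\<Sum>J\<in>\<J>. ennreal (p J * E + real n * \<gamma> * sqrt (v J)))"
      unfolding E_def using \<open>h > 0\<close> by (intro mult_left_mono sum_mono group) auto
    also have "(\<Sum>J\<in>\<J>. ennreal (p J * E + real n * \<gamma> * sqrt (v J)))
        = ennreal (\<Sum>J\<in>\<J>. p J * E + real n * \<gamma> * sqrt (v J))"
      using p_nonneg \<open>E \<ge> 0\<close> \<open>\<gamma> \<ge> 0\<close> v_nonneg by (intro sum_ennreal) auto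
    also have "(\<Sum>J\<in>\<J>. p J * E + real n * \<gamma> * sqrt (v J)) = E + real n * \<gamma> * W"
      using p_sum by (simp add: sum.distrib W_def flip: sum_distrib_right sum_distrib_left)
    also have "ennreal L * ennreal (E + real n * \<gamma> * W) = ennreal (L * (E + real n * \<gamma> * W))"
      using \<open>L > 0\<close> by (simp add: ennreal_mult')
    finally have "prob {\<omega> \<in> space M. s < S \<omega>} \<le> L * (E + real n * \<gamma> * W)"
      using \<open>L > 0\<close> \<open>W > 0\<close> \<open>E \<ge> 0\<close> \<open>\<gamma> \<ge> 0\<close> by (subst (asm) ennreal_le_iff) auto
    also have "\<dots> = L / (exp 1 * h) * exp (- h * (s - 1 / L) + h\<^sup>2 * W\<^sup>2 / 8) + L * W * (real n * \<gamma>)"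
      by (simp add: E_def \<theta>_def algebra_simps)
    finally show ?thesis .
  qed
  show ?thesis
    using that[OF \<open>W > 0\<close> W_le] tail unfolding S_def by blast
qed

section \<open>Choice of parameters\<close>

text \<open>
  Hoeffding's slope $4s/W^2$ leaves the exponential term sharp, at an error of $4 (s/W) N$, which is
  acceptable as long as $s l \le W^2$. For larger \<open>s\<close> the slack $l$ in the exponent is used to lower
  the slope to $2/l$. Half of the slack is kept in reserve, so that $s - l/2 \ge s/2$ and the
  exponent $h$ optimal for $s - l/2$ is at least the slope, even when $l$ is close to $s$.
\<close>

lemma tail_bound_optimize:
  fixes W l s N P :: real
  assumes "W > 0" "0 < l" "l < s" "N \<ge> 0"
    and tail: "\<And>L h. L > 0 \<Longrightarrow> h > 0 \<Longrightarrow>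
       P \<le> L / (exp 1 * h) * exp (- h * (s - 1 / L) + h\<^sup>2 * W\<^sup>2 / 8) + L * W * N"
  shows "P \<le> exp (- (2 * (s - l)\<^sup>2 / W\<^sup>2)) + 4 * N * sqrt (s / l)"
proof (cases "s * l \<le> W\<^sup>2")
  case True
  define h where "h = 4 * s / W\<^sup>2"
  have "h > 0" using assms by (simp add: h_def)
  have "P \<le> h / (exp 1 * h) * exp (- h * (s - 1 / h) + h\<^sup>2 * W\<^sup>2 / 8) + h * W * N"
    by (rule tail[OF \<open>h > 0\<close> \<open>h > 0\<close>])
  also have "h / (exp 1 * h) * exp (- h * (s - 1 / h) + h\<^sup>2 * W\<^sup>2 / 8)
      = exp (- h * (s - 1 / h) + h\<^sup>2 * W\<^sup>2 / 8 - 1)"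
    using \<open>h > 0\<close> by (simp add: exp_diff)
  also have "- h * (s - 1 / h) + h\<^sup>2 * W\<^sup>2 / 8 - 1 = - (2 * s\<^sup>2 / W\<^sup>2)"
  proof -
    have "- h * (s - 1 / h) + h\<^sup>2 * W\<^sup>2 / 8 - 1 = - (h * s) + h\<^sup>2 * W\<^sup>2 / 8"
      using \<open>h > 0\<close> by (simp add: algebra_simps)
    also have "\<dots> = - (2 * s\<^sup>2 / W\<^sup>2)"
      using \<open>W > 0\<close> by (simp add: h_def field_simps power2_eq_square)
    finally show ?thesis .
  qed
  also have "exp (- (2 * s\<^sup>2 / W\<^sup>2)) \<le> exp (- (2 * (s - l)\<^sup>2 / W\<^sup>2))"
    using assms by (auto intro!: divide_right_mono power_mono)
  also have "h * W * N \<le> 4 * N * sqrt (s / l)"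
  proof -
    have "s / W \<le> sqrt (s / l)"
    proof (rule real_le_rsqrt)
      have "s * (s * l) \<le> s * W\<^sup>2"
        using True assms by (intro mult_left_mono) auto
      then show "(s / W)\<^sup>2 \<le> s / l"
        using assms by (simp add: field_simps power2_eq_square)
    qed
    then have "4 * N * (s / W) \<le> 4 * N * sqrt (s / l)"
      using \<open>N \<ge> 0\<close> by (intro mult_left_mono) auto
    moreover have "h * W = 4 * (s / W)"
      using \<open>W > 0\<close> by (simp add: h_def power2_eq_square)
    ultimately show ?thesis by (simp add: ac_simps)
  qed
  finally show ?thesis by simp
next
  case False
  define h where "h = 4 * (s - l / 2) / W\<^sup>2"
  have "h > 0" using assms by (simp add: h_def)
  have "2 / l > 0" using assms by simp
  have "2 / l \<le> h"
  proof -
    have "2 * W\<^sup>2 \<le> 2 * (s * l)" using False by simp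
    also have "\<dots> \<le> 4 * (s - l / 2) * l"
    proof -
      have "l * l \<le> s * l" using assms by (intro mult_right_mono) auto
      then show ?thesis by (simp add: algebra_simps)
    qed
    finally show ?thesis
      using assms by (simp add: h_def field_simps)
  qed
  have "P \<le> (2 / l) / (exp 1 * h) * exp (- h * (s - 1 / (2 / l)) + h\<^sup>2 * W\<^sup>2 / 8) + (2 / l) * W * N"
    by (rule tail[OF \<open>2 / l > 0\<close> \<open>h > 0\<close>])
  also have "(2 / l) / (exp 1 * h) * exp (- h * (s - 1 / (2 / l)) + h\<^sup>2 * W\<^sup>2 / 8)
      \<le> 1 * exp (- h * (s - 1 / (2 / l)) + h\<^sup>2 * W\<^sup>2 / 8)"
  proof (intro mult_right_mono)
    note \<open>2 / l \<le> h\<close>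
    also have "h = 1 * h" by simp
    also have "\<dots> \<le> exp 1 * h"
      using \<open>h > 0\<close> by (intro mult_right_mono) auto
    finally show "(2 / l) / (exp 1 * h) \<le> 1"
      using \<open>h > 0\<close> by (subst divide_le_eq_1_pos) auto
  qed simp
  also have "- h * (s - 1 / (2 / l)) + h\<^sup>2 * W\<^sup>2 / 8 = - (2 * (s - l / 2)\<^sup>2 / W\<^sup>2)"
    using \<open>W > 0\<close> by (simp add: h_def field_simps power2_eq_square)
  also have "1 * exp (- (2 * (s - l / 2)\<^sup>2 / W\<^sup>2)) \<le> exp (- (2 * (s - l)\<^sup>2 / W\<^sup>2))"
    using assms by (auto intro!: divide_right_mono power_mono)
  also have "(2 / l) * W * N \<le> 4 * N * sqrt (s / l)"
  proof -
    have "W / l \<le> sqrt (s / l)"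
    proof (rule real_le_rsqrt)
      show "(W / l)\<^sup>2 \<le> s / l"
        using False assms by (simp add: field_simps power2_eq_square)
    qed
    then have "W / l \<le> 2 * sqrt (s / l)"
      using assms by (smt (verit) real_sqrt_ge_zero divide_nonneg_nonneg)
    then have "2 * N * (W / l) \<le> 2 * N * (2 * sqrt (s / l))"
      using \<open>N \<ge> 0\<close> by (intro mult_left_mono) auto
    then show ?thesis by (simp add: algebra_simps)
  qed
  finally show ?thesis by simp
qed

theorem theorem2:
  fixes M :: "'a measure" and X :: "nat \<Rightarrow> 'a \<Rightarrow> real"
    and n :: nat and a b :: "nat \<Rightarrow> real" and \<gamma> t lam :: real
  assumes "prob_space M"
    and "n \<ge> 1"
    and "\<And>i. i \<in> {1..n} \<Longrightarrow> X i \<in> borel_measurable M"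
    and "\<And>i. i \<in> {1..n} \<Longrightarrow> AE \<omega> in M. a i \<le> X i \<omega> \<and> X i \<omega> \<le> b i"
    and "\<gamma> > 0" and "t > 0" and "0 < lam" and "lam < t"
  shows "measure M {\<omega> \<in> space M.
            1 / real n * (\<Sum>i = 1..n. X i \<omega>) - 1 / real n * (\<Sum>i = 1..n. integral\<^sup>L M (X i)) > t}
         \<le> exp (- (2 * (real n)\<^sup>2 * (t - lam)\<^sup>2
                    / (real (soft_chromatic M X n \<gamma>) * (\<Sum>i = 1..n. (b i - a i)\<^sup>2))))
           + 18 * real n * \<gamma> * sqrt (Max ((\<lambda>i. \<bar>b i - a i\<bar>) ` {1..n}) / lam)"
proof -
  interpret prob_space M by fact
  note meas = assms(3) and bounds = assms(4)
  define r where "r = Max ((\<lambda>i. \<bar>b i - a i\<bar>) ` {1..n})"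
  define V where "V = (\<Sum>i = 1..n. (b i - a i)\<^sup>2)"
  define m where "m = soft_chromatic M X n \<gamma>"
  define P where "P = prob {\<omega> \<in> space M. real n * t < (\<Sum>i = 1..n. X i \<omega> - expectation (X i))}"
  have r_ge: "b i - a i \<le> r" if "i \<in> {1..n}" for i
  proof -
    have "\<bar>b i - a i\<bar> \<le> r"
      unfolding r_def using that by (intro Max_ge) auto
    then show ?thesis by simp
  qed
  have "r \<ge> 0"
  proof -
    have "\<bar>b 1 - a 1\<bar> \<le> r"
      unfolding r_def using \<open>n \<ge> 1\<close> by (intro Max_ge) auto
    then show ?thesis by linarith
  qed
  have "(1 / real n * (\<Sum>i = 1..n. X i \<omega>) - 1 / real n * (\<Sum>i = 1..n. expectation (X i)) > t)
      \<longleftrightarrow> real n * t < (\<Sum>i = 1..n. X i \<omega> - expectation (X i))" for \<omega>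
    using \<open>n \<ge> 1\<close> by (simp add: sum_subtractf field_simps flip: diff_divide_distrib)
  then have P_eq: "measure M {\<omega> \<in> space M.
      1 / real n * (\<Sum>i = 1..n. X i \<omega>) - 1 / real n * (\<Sum>i = 1..n. expectation (X i)) > t} = P"
    by (simp add: P_def)
  have "P \<le> exp (- (2 * (real n)\<^sup>2 * (t - lam)\<^sup>2 / (real m * V))) + 18 * real n * \<gamma> * sqrt (r / lam)"
  proof (cases "V = 0 \<or> r < t")
    case True
    have err: "0 \<le> 18 * real n * \<gamma> * sqrt (r / lam)"
      using \<open>\<gamma> > 0\<close> \<open>r \<ge> 0\<close> \<open>0 < lam\<close> by simp
    show ?thesis
    proof (cases "V = 0")
      case True
      have "P \<le> 1" unfolding P_def by (rule prob_le_1)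
      moreover have "exp (- (2 * (real n)\<^sup>2 * (t - lam)\<^sup>2 / (real m * V))) = 1"
        using True by simp
      ultimately show ?thesis using err by linarith
    next
      case False
      with True have "r < t" by simp
      have "AE \<omega> in M. \<forall>i\<in>{1..n}. X i \<omega> - expectation (X i) \<le> b i - a i"
        by (intro AE_finite_allI centered_le_width meas bounds) auto
      then have "AE \<omega> in M. \<not> real n * t < (\<Sum>i = 1..n. X i \<omega> - expectation (X i))"
      proof eventually_elim
        case (elim \<omega>)
        have "(\<Sum>i = 1..n. X i \<omega> - expectation (X i)) \<le> (\<Sum>i = 1..n. r)"
          using elim r_ge by (intro sum_mono) (meson order_trans)
        also have "\<dots> \<le> real n * t"
          using \<open>r < t\<close> by (simp add: mult_left_mono)
        finally show ?case by simp
      qed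
      then have "P = 0"
        unfolding P_def using meas by (subst prob_eq_0) (auto intro!: borel_measurable_sum)
      then show ?thesis using err by (simp add: add_nonneg_nonneg)
    qed
  next
    case False
    then have "V \<noteq> 0" "t \<le> r" by auto
    obtain \<J> where cover: "soft_cover M X n \<gamma> \<J>" and card: "card \<J> = m"
      using soft_chromatic_attained[of \<gamma> X n] \<open>\<gamma> > 0\<close> unfolding m_def by auto
    obtain W where "W > 0" and W: "W\<^sup>2 \<le> real m * V"
      and tail: "\<And>L h s. L > 0 \<Longrightarrow> h > 0 \<Longrightarrow>
       prob {\<omega> \<in> space M. s < (\<Sum>i = 1..n. X i \<omega> - expectation (X i))}
         \<le> L / (exp 1 * h) * exp (- h * (s - 1 / L) + h\<^sup>2 * W\<^sup>2 / 8) + L * W * (real n * \<gamma>)"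
    proof (rule soft_cover_tail[OF cover, where a = a and b = b])
      fix W :: real
      assume "W > 0" and W: "W\<^sup>2 \<le> real (card \<J>) * (\<Sum>i = 1..n. (b i - a i)\<^sup>2)"
        and tail: "\<And>L h s. L > 0 \<Longrightarrow> h > 0 \<Longrightarrow>
       prob {\<omega> \<in> space M. s < (\<Sum>i = 1..n. X i \<omega> - expectation (X i))}
         \<le> L / (exp 1 * h) * exp (- h * (s - 1 / L) + h\<^sup>2 * W\<^sup>2 / 8) + L * W * (real n * \<gamma>)"
      show thesis
        by (rule that[OF \<open>W > 0\<close> _ tail]) (use W in \<open>simp_all add: V_def card\<close>)
    qed (use meas bounds \<open>\<gamma> > 0\<close> \<open>V \<noteq> 0\<close> in \<open>simp_all add: V_def\<close>)
    have "P \<le> exp (- (2 * (real n * t - real n * lam)\<^sup>2 / W\<^sup>2))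
        + 4 * (real n * \<gamma>) * sqrt (real n * t / (real n * lam))"
      unfolding P_def
    proof (rule tail_bound_optimize[OF \<open>W > 0\<close> _ _ _ tail])
      show "0 < real n * lam" "real n * lam < real n * t" "0 \<le> real n * \<gamma>"
        using \<open>n \<ge> 1\<close> \<open>0 < lam\<close> \<open>lam < t\<close> \<open>\<gamma> > 0\<close> by simp_all
    qed
    also have "\<dots> \<le> exp (- (2 * (real n)\<^sup>2 * (t - lam)\<^sup>2 / (real m * V)))
        + 18 * (real n * \<gamma>) * sqrt (r / lam)"
    proof (intro add_mono mult_mono)
      have pos: "0 < real m * V"
        using zero_less_power[OF \<open>W > 0\<close>, of 2] W by (rule less_le_trans)
      have sq: "2 * (real n * t - real n * lam)\<^sup>2 = 2 * (real n)\<^sup>2 * (t - lam)\<^sup>2"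
        by (simp add: power_mult_distrib flip: right_diff_distrib)
      have "2 * (real n)\<^sup>2 * (t - lam)\<^sup>2 / (real m * V) \<le> 2 * (real n)\<^sup>2 * (t - lam)\<^sup>2 / W\<^sup>2"
        using W \<open>W > 0\<close> by (intro divide_left_mono mult_pos_pos[OF pos]) auto
      then show "exp (- (2 * (real n * t - real n * lam)\<^sup>2 / W\<^sup>2))
          \<le> exp (- (2 * (real n)\<^sup>2 * (t - lam)\<^sup>2 / (real m * V)))"
        by (simp add: sq)
      show "sqrt (real n * t / (real n * lam)) \<le> sqrt (r / lam)"
        using \<open>t \<le> r\<close> \<open>n \<ge> 1\<close> \<open>0 < lam\<close> by (simp add: divide_right_mono)
    qed (use \<open>\<gamma> > 0\<close> \<open>r \<ge> 0\<close> \<open>0 < lam\<close> \<open>lam < t\<close> in auto)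
    finally show ?thesis by (simp add: mult.assoc)
  qed
  then show ?thesis
    unfolding P_eq r_def V_def m_def .
qed

end
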